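(* Let $q$ be a prime power not divisible by $2$ or $3$. Fix a positive integer $m$, a nonzero square $d\in(\mathbb F_q^\times)^2$, some $t\in\mathbb F_q$, and an invertible $2m\times2m$ alternating matrix $T$ over $\mathbb F_q$. The number $N(d,t,T)$ of alternating matrices $A\in\mathrm{GL}_{2m}(\mathbb F_q)$ with $(\det A,\operatorname{tr}AT)=(d,t)$ satisfies $$\left|N(d,t,T)-\frac{N}{q(q-1)/2}\right|\le q^{m(m-1)}(q-1)^m,$$ where $N$ is the total number of invertible alternating $2m\times2m$ matrices over $\mathbb F_q$.
   Context: A square matrix $A$ over $\mathbb F_q$ ($q$ odd) is alternating if $A^\intercal=-A$. *)

theory Defs
  imports Complex_Main "HOL-Library.Cardinality" "Jordan_Normal_Form.Determinant"
begin

text \<open>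
  Alternating is taken in the sense appropriate to odd characteristic: the diagonal is not
  separately required to vanish. The equation itself forces \<open>A\<close> to be square.
\<close>
definition alternating_mat :: "'a::ring_1 mat \<Rightarrow> bool"
  where "alternating_mat A \<longleftrightarrow> transpose_mat A = - A"

definition mat_trace :: "'a::comm_monoid_add mat \<Rightarrow> 'a"
  where "mat_trace A = (\<Sum>i<dim_row A. A $$ (i, i))"

definition alternating_GL :: "nat \<Rightarrow> 'a::ring_1 mat set"
  where "alternating_GL n = {A \<in> carrier_mat n n. alternating_mat A \<and> invertible_mat A}"

end

theory Submission
  imports Defs
begin

text \<open>
  Write \<open>F(d, t)\<close> for the number of invertible alternating \<open>A\<close> of size \<open>2m\<close> with determinant \<open>d\<close> and
  \<open>tr (A T) = t\<close>. The heart of the proof is the bound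
  \<open>\<bar>F(d, t) - F(d, t')\<bar> \<le> q^(m(m-1)) (q-1)^m\<close> for all \<open>t, t'\<close>; it is proved by induction on \<open>m\<close>,
  without any character sums.

  A congruence of \<open>T\<close> only rescales the determinant coordinate, so \<open>T\<close> may be taken block diagonal,
  with a block \<open>((0, b), (-b, 0))\<close> followed by an invertible alternating \<open>S\<close> of size \<open>n = 2m - 2\<close>
  (\<open>alternating_GL_induct\<close>, \<open>card_trace_fibre_congr\<close>). Then \<open>tr (A T) = tr (D S) - 2 b A\<^sub>0\<^sub>1\<close>, where \<open>D\<close>
  is the lower right block of \<open>A\<close>. The matrices \<open>A\<close> of size \<open>2 + n\<close> fall into two classes.

  \<^item> Some \<open>A\<^sub>0\<^sub>j\<close> with \<open>j \<ge> 2\<close> is nonzero. Adding \<open>s\<close> times row and column \<open>j\<close> to row and column \<open>1\<close>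
    changes \<open>A\<^sub>0\<^sub>1\<close> by \<open>s A\<^sub>0\<^sub>j\<close> and leaves \<open>D\<close>, the determinant and the rest of row \<open>0\<close> alone. Hence
    all trace values are equally frequent in this class (\<open>card_linked_fibre_le\<close>).
  \<^item> Row \<open>0\<close> of \<open>A\<close> is \<open>(0, x, 0, ..., 0)\<close>. Then \<open>A\<close> is given freely by \<open>x \<noteq> 0\<close>, by the other \<open>n\<close>
    entries of row \<open>1\<close>, and by an invertible alternating \<open>D\<close>, and \<open>det A = x^2 det D\<close>
    (\<open>card_isolated_fibre\<close>). The deviation is thus at most \<open>q^n (q-1)\<close> times the one for size \<open>n\<close>.

  Multiplying the factors \<open>q^(2k) (q-1)\<close> for \<open>k < m\<close> gives the bound. A value of \<open>F(d, _)\<close> differs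
  from the mean by at most the largest difference of two values, and the mean is
  \<open>2 N / (q (q-1))\<close>: determinants of invertible alternating matrices are nonzero squares, and
  congruence by \<open>diag(s, 1, ..., 1)\<close> shows that all nonzero squares are equally frequent.
\<close>

section \<open>Alternating matrices and congruence\<close>

lemma invertible_mat_iff_det:
  fixes A :: "'a::field mat"
  assumes A: "A \<in> carrier_mat n n"
  shows "invertible_mat A \<longleftrightarrow> det A \<noteq> 0"
proof
  assume "invertible_mat A"
  then obtain B where AB: "A * B = 1\<^sub>m n" and BA: "B * A = 1\<^sub>m (dim_row B)"
    using A unfolding invertible_mat_def inverts_mat_def by auto
  have B: "B \<in> carrier_mat n n"
    using A arg_cong[OF AB, of dim_col] arg_cong[OF BA, of dim_col] by (auto intro: carrier_matI)
  show "det A \<noteq> 0"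
    using det_mult[OF A B] AB by auto
next
  assume "det A \<noteq> 0"
  from det_non_zero_imp_unit[OF A this, of undefined] obtain B where
    "B \<in> carrier_mat n n" "B * A = 1\<^sub>m n" "A * B = 1\<^sub>m n"
    unfolding Units_def ring_mat_def by auto
  then show "invertible_mat A"
    using A unfolding invertible_mat_def inverts_mat_def by auto
qed

lemma alternating_GL_iff:
  fixes A :: "'a::field mat"
  shows "A \<in> alternating_GL n \<longleftrightarrow>
    A \<in> carrier_mat n n \<and> transpose_mat A = - A \<and> det A \<noteq> 0"
  using invertible_mat_iff_det[of A n] unfolding alternating_GL_def alternating_mat_def by auto

lemma alternating_index:
  fixes A :: "'a::field mat"
  assumes "A \<in> carrier_mat n n" "transpose_mat A = - A" "i < n" "j < n"
  shows "A $$ (j, i) = - A $$ (i, j)"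
  using arg_cong[OF assms(2), of "\<lambda>M. M $$ (i, j)"] assms(1,3,4) by auto

lemma alternating_diag:
  fixes A :: "'a::field mat"
  assumes "(2::'a) \<noteq> 0" "A \<in> carrier_mat n n" "transpose_mat A = - A" "i < n"
  shows "A $$ (i, i) = 0"
proof -
  have "2 * A $$ (i, i) = 0"
    using alternating_index[OF assms(2-4,4)] by (metis add.right_inverse mult_2)
  then show ?thesis using assms(1) by simp
qed

definition congr_mat :: "'a::comm_ring_1 mat \<Rightarrow> 'a mat \<Rightarrow> 'a mat"
  where "congr_mat P A = P * A * transpose_mat P"

lemma congr_mat_carrier [simp]:
  "P \<in> carrier_mat n n \<Longrightarrow> A \<in> carrier_mat n n \<Longrightarrow> congr_mat P A \<in> carrier_mat n n"
  unfolding congr_mat_def by auto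

lemma congr_mat_one: "A \<in> carrier_mat n n \<Longrightarrow> congr_mat (1\<^sub>m n) A = A"
  unfolding congr_mat_def by auto

lemma congr_mat_mult:
  assumes P: "P \<in> carrier_mat n n" and Q: "Q \<in> carrier_mat n n" and A: "A \<in> carrier_mat n n"
  shows "congr_mat P (congr_mat Q A) = congr_mat (P * Q) A"
proof -
  note [simp] = assoc_mult_mat[of _ n n _ n _ n]
  show ?thesis
    using assms unfolding congr_mat_def by (simp add: transpose_mult[OF P Q])
qed

lemma congr_mat_cancel:
  assumes "P \<in> carrier_mat n n" "Q \<in> carrier_mat n n" "A \<in> carrier_mat n n" "Q * P = 1\<^sub>m n"
  shows "congr_mat Q (congr_mat P A) = A"
  using congr_mat_mult[OF assms(2,1,3)] congr_mat_one[OF assms(3)] assms(4) by simp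

lemma det_congr_mat:
  assumes P: "P \<in> carrier_mat n n" and A: "A \<in> carrier_mat n n"
  shows "det (congr_mat P A) = (det P)\<^sup>2 * det A"
  unfolding congr_mat_def
  using det_mult[of "P * A" n "transpose_mat P"] det_mult[OF P A] det_transpose[OF P] P A
  by (simp add: power2_eq_square mult_ac)

lemma transpose_congr_mat:
  assumes P: "P \<in> carrier_mat n n" and A: "A \<in> carrier_mat n n" and alt: "transpose_mat A = - A"
  shows "transpose_mat (congr_mat P A) = - congr_mat P A"
proof -
  have "transpose_mat (congr_mat P A) = P * (transpose_mat A * transpose_mat P)"
    unfolding congr_mat_def using P A by (simp add: transpose_mult[of _ n n _ n])
  also have "\<dots> = - congr_mat P A"
    unfolding alt congr_mat_def using P A
    by (simp add: assoc_mult_mat[of _ n n _ n _ n])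
  finally show ?thesis .
qed

lemma congr_mat_alternating_GL:
  fixes A :: "'a::field mat"
  assumes "P \<in> carrier_mat n n" "det P \<noteq> 0" "A \<in> alternating_GL n"
  shows "congr_mat P A \<in> alternating_GL n"
  using assms det_congr_mat[of P n A] transpose_congr_mat[of P n A]
  unfolding alternating_GL_iff by simp

text \<open>
  The quadratic term \<open>s^2 A\<^sub>l\<^sub>l\<close> at position \<open>(k, k)\<close> vanishes because \<open>A\<close> is alternating, so the
  formula is linear in \<open>s\<close>.
\<close>
lemma congr_mat_addrow_index:
  fixes A :: "'a::field mat"
  assumes A: "A \<in> carrier_mat n n" "transpose_mat A = - A" and c: "(2::'a) \<noteq> 0"
    and ij: "i < n" "j < n" and kl: "k < n" "l < n"
  shows "congr_mat (addrow_mat n s k l) A $$ (i, j) =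
    A $$ (i, j) + (if i = k then s * A $$ (l, j) else 0) + (if j = k then s * A $$ (i, l) else 0)"
proof -
  let ?P = "addrow_mat n s k l"
  let ?B = "addrow s k l A"
  have B: "?B \<in> carrier_mat n n" using A by simp
  have "congr_mat ?P A = ?B * transpose_mat ?P"
    unfolding congr_mat_def using addrow_mat[OF A(1) kl(2)] by simp
  also have "\<dots> = transpose_mat (?P * transpose_mat ?B)"
    using B by (simp add: transpose_mult[of _ n n _ n])
  also have "?P * transpose_mat ?B = addrow s k l (transpose_mat ?B)"
    using B kl by (intro addrow_mat[symmetric]) auto
  finally show ?thesis
    using A(1) ij kl alternating_diag[OF c A(1,2) kl(2)] by (auto simp: algebra_simps)
qed

lemma mat_trace_comm:
  fixes A B :: "'a::comm_ring_1 mat"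
  assumes A: "A \<in> carrier_mat n n" and B: "B \<in> carrier_mat n n"
  shows "mat_trace (A * B) = mat_trace (B * A)"
proof -
  have "mat_trace (A * B) = (\<Sum>i<n. \<Sum>k<n. A $$ (i, k) * B $$ (k, i))"
    using A B unfolding mat_trace_def by (simp add: scalar_prod_def atLeast0LessThan)
  also have "\<dots> = (\<Sum>k<n. \<Sum>i<n. B $$ (k, i) * A $$ (i, k))"
    by (subst sum.swap) (simp add: mult.commute)
  also have "\<dots> = mat_trace (B * A)"
    using A B unfolding mat_trace_def by (simp add: scalar_prod_def atLeast0LessThan)
  finally show ?thesis .
qed

section \<open>Bordering an alternating matrix by a hyperbolic block\<close>

definition alt2 :: "'a::ring_1 \<Rightarrow> 'a mat"
  where "alt2 b = mat 2 2 (\<lambda>(i, j). if i = 0 \<and> j = 1 then b else if i = 1 \<and> j = 0 then - b else 0)"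

lemma alt2_carrier [simp]: "alt2 b \<in> carrier_mat 2 2" "dim_row (alt2 b) = 2" "dim_col (alt2 b) = 2"
  unfolding alt2_def by auto

lemma alt2_index [simp]:
  "alt2 b $$ (0, 0) = 0" "alt2 b $$ (0, Suc 0) = b" "alt2 b $$ (Suc 0, 0) = - b"
  "alt2 b $$ (Suc 0, Suc 0) = 0"
  unfolding alt2_def by auto

lemma transpose_alt2: "transpose_mat (alt2 b) = - alt2 b"
  unfolding alt2_def by (rule eq_matI) auto

lemma sum_below_2: "(\<Sum>k = 0..<2. f k) = f 0 + f (Suc 0)"
  by (simp add: numeral_2_eq_2)

lemma alt2_mult: "alt2 a * alt2 b = - (a * b) \<cdot>\<^sub>m (1\<^sub>m 2 :: 'a::comm_ring_1 mat)"
  by (rule eq_matI) (auto simp: less_2_cases_iff scalar_prod_def sum_below_2)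

lemma det_alt2: "det (alt2 (b::'a::comm_ring_1)) = b\<^sup>2"
proof -
  have "det (alt2 b) = (\<Sum>i<2. alt2 b $$ (i, 0) * cofactor (alt2 b) i 0)"
    by (rule laplace_expansion_column) auto
  also have "\<dots> = b\<^sup>2"
    by (simp add: numeral_2_eq_2 cofactor_def mat_delete_def det_single alt2_def power2_eq_square)
  finally show ?thesis .
qed

definition bordered :: "'a::ring_1 \<Rightarrow> 'a mat \<Rightarrow> 'a mat \<Rightarrow> 'a mat"
  where "bordered x C D = four_block_mat (alt2 x) C (- transpose_mat C) D"

lemma bordered_carrier [simp]:
  "D \<in> carrier_mat n n \<Longrightarrow> bordered x C D \<in> carrier_mat (2 + n) (2 + n)"
  unfolding bordered_def by (intro four_block_carrier_mat) auto

lemma bordered_zero: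
  "bordered b (0\<^sub>m 2 n) D = four_block_mat (alt2 b) (0\<^sub>m 2 n) (0\<^sub>m n 2) D"
  unfolding bordered_def by (rule arg_cong) (rule cong_four_block_mat; auto)

lemma transpose_bordered:
  assumes C: "C \<in> carrier_mat 2 n" and D: "D \<in> carrier_mat n n" and alt: "transpose_mat D = - D"
  shows "transpose_mat (bordered x C D) = - bordered x C D"
proof -
  have *: "transpose_mat (- transpose_mat C) = - C"
    by (rule eq_matI) auto
  have "transpose_mat (bordered x C D) = four_block_mat (- alt2 x) (- C) (transpose_mat C) (- D)"
    unfolding bordered_def using C D
    by (subst transpose_four_block_mat[of _ 2 2 _ n _ n]) (auto simp: transpose_alt2 alt *)
  also have "\<dots> = - bordered x C D"
    unfolding bordered_def using C D by (intro eq_matI) auto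
  finally show ?thesis .
qed

lemma alternating_eq_bordered:
  fixes A :: "'a::field mat"
  assumes A: "A \<in> carrier_mat (2 + n) (2 + n)" "transpose_mat A = - A" and c: "(2::'a) \<noteq> 0"
  shows "A = bordered (A $$ (0, 1)) (mat 2 n (\<lambda>(i, j). A $$ (i, j + 2)))
    (mat n n (\<lambda>(i, j). A $$ (i + 2, j + 2)))"
proof -
  have d: "A $$ (0, 0) = 0" "A $$ (Suc 0, Suc 0) = 0" "A $$ (Suc 0, 0) = - A $$ (0, Suc 0)"
    using alternating_diag[OF c A] alternating_index[OF A, of 0 "Suc 0"] by auto
  have lower: "A $$ (i, j) = - A $$ (j, i)" if "2 \<le> i" "i < 2 + n" "j < 2" for i j
    using alternating_index[OF A, of j i] that by simp
  have [simp]: "Suc (Suc (k - 2)) = k" if "2 \<le> k" for k :: nat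
    using that by simp
  show ?thesis (is "A = ?R")
  proof (rule eq_matI)
    fix i j
    assume "i < dim_row ?R" "j < dim_col ?R"
    then have ij: "i < 2 + n" "j < 2 + n" by (auto simp: bordered_def)
    consider "i < 2" "j < 2" | "i < 2" "2 \<le> j" | "2 \<le> i" "j < 2" | "2 \<le> i" "2 \<le> j"
      by linarith
    then show "A $$ (i, j) = ?R $$ (i, j)"
    proof cases
      case 1
      then show ?thesis using d ij unfolding bordered_def by (auto simp: less_2_cases_iff)
    next
      case 2
      then show ?thesis using ij unfolding bordered_def by simp
    next
      case 3
      then show ?thesis using ij lower[of i j] unfolding bordered_def by simp
    next
      case 4
      then show ?thesis using ij unfolding bordered_def by simp
    qed
  qed (use A(1) in \<open>auto simp: bordered_def\<close>)
qed

text \<open>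
  Block elimination: since \<open>alt2 (1 / x)\<close> is the inverse of \<open>- alt2 x\<close>, a unipotent block matrix clears the
  border \<open>C\<close> and leaves the Schur complement of \<open>alt2 x\<close>. Being unipotent, it does not change the
  determinant.
\<close>
lemma bordered_congruent_diagonal:
  fixes C D :: "'a::field mat"
  assumes x: "x \<noteq> 0" and C: "C \<in> carrier_mat 2 n" and D: "D \<in> carrier_mat n n"
  obtains L where "L \<in> carrier_mat (2 + n) (2 + n)" "det L = 1"
    "bordered x C D =
      congr_mat L (bordered x (0\<^sub>m 2 n) (D - transpose_mat C * alt2 (1 / x) * C))"
proof -
  let ?B = "alt2 x" and ?X = "transpose_mat C * alt2 (1 / x)"
  let ?S = "D - ?X * C"
  let ?L = "four_block_mat (1\<^sub>m 2) (0\<^sub>m 2 n) ?X (1\<^sub>m n)"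
  have X: "?X \<in> carrier_mat n 2" using C by auto
  have S: "?S \<in> carrier_mat n n" using C D X by auto
  have XB: "?X * ?B = - transpose_mat C"
    using C x by (simp add: assoc_mult_mat[of _ n 2 _ 2 _ 2] alt2_mult) auto
  have XT: "transpose_mat ?X = - (alt2 (1 / x) * C)"
    using C by (simp add: transpose_mult[of _ n 2 _ 2] transpose_alt2)
  have BX: "?B * transpose_mat ?X = C"
    unfolding XT using C x
    by (simp add: assoc_mult_mat[of _ 2 2 _ 2 _ n, symmetric] alt2_mult
        mult_smult_assoc_mat[of _ 2 2 _ n]) (rule eq_matI; auto)
  show ?thesis
  proof (rule that[of ?L])
    show "?L \<in> carrier_mat (2 + n) (2 + n)" by (intro four_block_carrier_mat) auto
    show "det ?L = 1"
      using det_four_block_mat_upper_right_zero[of "1\<^sub>m 2" 2 "0\<^sub>m 2 n" n ?X "1\<^sub>m n"] X by simp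
    have "?L * bordered x (0\<^sub>m 2 n) ?S = four_block_mat ?B (0\<^sub>m 2 n) (- transpose_mat C) ?S"
      unfolding bordered_zero using X S C
      by (subst mult_four_block_mat[of _ 2 2 _ n _ n _ _ 2 _ n]) (auto simp: XB)
    then have "congr_mat ?L (bordered x (0\<^sub>m 2 n) ?S) =
      four_block_mat ?B (0\<^sub>m 2 n) (- transpose_mat C) ?S *
      four_block_mat (1\<^sub>m 2) (transpose_mat ?X) (0\<^sub>m n 2) (1\<^sub>m n)"
      unfolding congr_mat_def using X
      by (subst transpose_four_block_mat[of _ 2 2 _ n _ n]) auto
    also have "\<dots> = bordered x C D"
    proof -
      have 1: "- transpose_mat C * transpose_mat ?X + ?S = D"
      proof -
        have "- transpose_mat C * transpose_mat ?X = ?X * C"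
          unfolding XT using C by (simp add: assoc_mult_mat[of _ n 2 _ 2 _ n])
        then show ?thesis using X C D by (intro eq_matI) auto
      qed
      show ?thesis
        unfolding bordered_def using X S C D 1
        by (subst mult_four_block_mat[of _ 2 2 _ n _ n _ _ 2 _ n]) (auto simp: BX)
    qed
    finally show "bordered x C D = congr_mat ?L (bordered x (0\<^sub>m 2 n) ?S)" by simp
  qed
qed

lemma transpose_schur_complement:
  fixes C D :: "'a::comm_ring_1 mat"
  assumes C: "C \<in> carrier_mat 2 n" and D: "D \<in> carrier_mat n n" and alt: "transpose_mat D = - D"
  shows "transpose_mat (D - transpose_mat C * alt2 y * C) = - (D - transpose_mat C * alt2 y * C)"
proof -
  let ?M = "transpose_mat C * alt2 y * C"
  have M: "?M \<in> carrier_mat n n" using C by auto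
  have MT: "transpose_mat ?M = - ?M"
  proof -
    have "transpose_mat ?M = transpose_mat C * (transpose_mat (alt2 y) * C)"
      using C transpose_mult[of "transpose_mat C * alt2 y" n 2 C n]
        transpose_mult[of "transpose_mat C" n 2 "alt2 y" 2] by simp
    also have "\<dots> = - (transpose_mat C * (alt2 y * C))"
      using C by (simp add: transpose_alt2)
    also have "\<dots> = - ?M"
      using C by (simp add: assoc_mult_mat[of _ n 2 _ 2 _ n])
    finally show ?thesis .
  qed
  have "transpose_mat (D - ?M) = transpose_mat D - transpose_mat ?M"
    using D M by (intro eq_matI) auto
  also have "\<dots> = - (D - ?M)"
    unfolding alt MT using D M by (intro eq_matI) auto
  finally show ?thesis .
qed

lemma det_bordered_zero:
  fixes D :: "'a::field mat"
  assumes "D \<in> carrier_mat n n"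
  shows "det (bordered x (0\<^sub>m 2 n) D) = x\<^sup>2 * det D"
  unfolding bordered_zero
  using det_four_block_mat_upper_right_zero[of "alt2 x" 2 "0\<^sub>m 2 n" n "0\<^sub>m n 2" D] assms
  by (simp add: det_alt2)

lemma lower_right_alternating:
  fixes A :: "'a::field mat"
  assumes A: "A \<in> carrier_mat (2 + n) (2 + n)" "transpose_mat A = - A"
  shows "transpose_mat (mat n n (\<lambda>(i, j). A $$ (i + 2, j + 2))) =
    - mat n n (\<lambda>(i, j). A $$ (i + 2, j + 2))"
  by (rule eq_matI) (auto intro!: alternating_index[OF A])

lemma alternating_GL_row_nonzero:
  fixes A :: "'a::field mat"
  assumes "A \<in> alternating_GL n" "i < n"
  shows "\<exists>j<n. A $$ (i, j) \<noteq> 0"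
proof (rule ccontr)
  assume "\<not> (\<exists>j<n. A $$ (i, j) \<noteq> 0)"
  then have "det A = 0"
    using laplace_expansion_row[of A n i] assms unfolding alternating_GL_iff by simp
  then show False using assms(1) unfolding alternating_GL_iff by simp
qed

section \<open>Induction along congruence classes\<close>

text \<open>
  Symplectic reduction as an induction principle: a property of invertible alternating matrices that
  survives congruence and the addition of an orthogonal hyperbolic block holds for all of them. In
  this form the reducing matrix never has to be named, and the parameter \<open>b\<close> of the block need not be
  normalised to \<open>1\<close>.
\<close>
lemma alternating_GL_induct [consumes 2, case_names empty block congr]:
  fixes T :: "'a::field mat"
  assumes c: "(2::'a) \<noteq> 0" and T: "T \<in> alternating_GL (2 * m)"
    and empty: "\<And>T. T \<in> carrier_mat 0 0 \<Longrightarrow> Q 0 T"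
    and block: "\<And>m b S. b \<noteq> 0 \<Longrightarrow> S \<in> alternating_GL (2 * m) \<Longrightarrow> Q m S \<Longrightarrow>
      Q (Suc m) (bordered b (0\<^sub>m 2 (2 * m)) S)"
    and congr: "\<And>m P S. P \<in> carrier_mat (2 * m) (2 * m) \<Longrightarrow> det P \<noteq> 0 \<Longrightarrow>
      S \<in> alternating_GL (2 * m) \<Longrightarrow> Q m S \<Longrightarrow> Q m (congr_mat P S)"
  shows "Q m T"
  using T
proof (induction m arbitrary: T)
  case 0
  then show ?case by (intro empty) (simp add: alternating_GL_iff)
next
  case (Suc m)
  define n where "n = 2 * m"
  have n: "2 * Suc m = 2 + n" unfolding n_def by simp
  have pivot: "Q (Suc m) A" if A: "A \<in> alternating_GL (2 + n)" and x: "A $$ (0, 1) \<noteq> 0" for A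
  proof -
    let ?x = "A $$ (0, 1)"
    let ?C = "mat 2 n (\<lambda>(i, j). A $$ (i, j + 2))"
    let ?D = "mat n n (\<lambda>(i, j). A $$ (i + 2, j + 2))"
    let ?S = "?D - transpose_mat ?C * alt2 (1 / ?x) * ?C"
    have A': "A \<in> carrier_mat (2 + n) (2 + n)" "transpose_mat A = - A" "det A \<noteq> 0"
      using A unfolding alternating_GL_iff by auto
    have S: "?S \<in> carrier_mat n n" by (intro minus_carrier_mat mult_carrier_mat[of _ n 2]) auto
    obtain L where L: "L \<in> carrier_mat (2 + n) (2 + n)" "det L = 1"
      and AL: "A = congr_mat L (bordered ?x (0\<^sub>m 2 n) ?S)"
      using bordered_congruent_diagonal[OF x, of ?C n ?D] alternating_eq_bordered[OF A'(1,2) c]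
      by auto
    have dA: "det A = ?x\<^sup>2 * det ?S"
      using arg_cong[OF AL, of det] det_congr_mat[OF L(1) bordered_carrier[OF S]]
        det_bordered_zero[OF S] L(2) by simp
    have alt: "transpose_mat ?S = - ?S"
      by (intro transpose_schur_complement lower_right_alternating A') auto
    have SG: "?S \<in> alternating_GL n"
      using S alt dA A'(3) unfolding alternating_GL_iff by auto
    have BG: "bordered ?x (0\<^sub>m 2 n) ?S \<in> alternating_GL (2 + n)"
      unfolding alternating_GL_iff
    proof (intro conjI)
      show "bordered ?x (0\<^sub>m 2 n) ?S \<in> carrier_mat (2 + n) (2 + n)"
        by (rule bordered_carrier[OF S])
      show "transpose_mat (bordered ?x (0\<^sub>m 2 n) ?S) = - bordered ?x (0\<^sub>m 2 n) ?S"
        by (rule transpose_bordered[OF _ S alt]) simp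
      show "det (bordered ?x (0\<^sub>m 2 n) ?S) \<noteq> 0"
        unfolding det_bordered_zero[OF S] dA[symmetric] by (rule A'(3))
    qed
    have "Q (Suc m) (bordered ?x (0\<^sub>m 2 n) ?S)"
      using block[OF x SG[unfolded n_def] Suc.IH[OF SG[unfolded n_def]]] unfolding n_def .
    then have "Q (Suc m) (congr_mat L (bordered ?x (0\<^sub>m 2 n) ?S))"
      using congr[of L "Suc m"] L BG unfolding n by auto
    then show ?thesis using AL by simp
  qed
  have T: "T \<in> alternating_GL (2 + n)"
    using Suc.prems unfolding n .
  then have T': "T \<in> carrier_mat (2 + n) (2 + n)" "transpose_mat T = - T"
    unfolding alternating_GL_iff by auto
  show ?case
  proof (cases "T $$ (0, 1) = 0")
    case False
    then show ?thesis using pivot[OF T] by simp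
  next
    case True
    \<comment> \<open>A transvection moves a nonzero entry of row 0 to the pivot position \<open>(0, 1)\<close>.\<close>
    obtain j where j: "j < 2 + n" "T $$ (0, j) \<noteq> 0"
      using alternating_GL_row_nonzero[OF T, of 0] by auto
    have j2: "j \<noteq> 0" "j \<noteq> 1"
      using j(2) True alternating_diag[OF c T', of 0] by - (rule notI, simp)+
    define E where "E s = addrow_mat (2 + n) (s::'a) 1 j" for s
    have E: "E s \<in> carrier_mat (2 + n) (2 + n)" "det (E s) = 1" for s
      using j2 unfolding E_def by (auto simp: det_addrow_mat)
    have inv: "E (-1) * E 1 = 1\<^sub>m (2 + n)"
      using addrow_mat_inv[of 1 "2 + n" j "- 1"] j j2 unfolding E_def by auto
    have "congr_mat (E 1) T $$ (0, 1) = T $$ (0, j)"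
      unfolding E_def using congr_mat_addrow_index[OF T' c, of 0 1 1 j 1] j True by simp
    then have "Q (Suc m) (congr_mat (E 1) T)"
      using pivot[OF congr_mat_alternating_GL[OF E(1) _ T]] E(2) j by simp
    then have "Q (Suc m) (congr_mat (E (-1)) (congr_mat (E 1) T))"
      using congr[of "E (-1)" "Suc m"] E congr_mat_alternating_GL[OF E(1) _ T] unfolding n by simp
    then show ?thesis
      using congr_mat_cancel[OF E(1) E(1) T'(1) inv] by simp
  qed
qed

lemma det_alternating_square:
  fixes A :: "'a::field mat"
  assumes c: "(2::'a) \<noteq> 0" and A: "A \<in> alternating_GL (2 * m)"
  shows "\<exists>s. s \<noteq> 0 \<and> det A = s\<^sup>2"
  using c A
proof (induction rule: alternating_GL_induct)
  case (empty T)
  then show ?case by (intro exI[of _ 1]) simp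
next
  case (block m b S)
  then obtain s where "s \<noteq> 0" "det S = s\<^sup>2" by blast
  with block show ?case
    by (intro exI[of _ "b * s"]) (simp add: alternating_GL_iff det_bordered_zero power_mult_distrib)
next
  case (congr m P S)
  then obtain s where "s \<noteq> 0" "det S = s\<^sup>2" by blast
  with congr show ?case
    by (intro exI[of _ "det P * s"])
      (auto simp: alternating_GL_iff det_congr_mat power_mult_distrib)
qed

section \<open>The joint fibres of determinant and trace\<close>

definition trace_fibre :: "nat \<Rightarrow> 'a::field mat \<Rightarrow> 'a \<Rightarrow> 'a \<Rightarrow> 'a mat set"
  where "trace_fibre n T d t = {A \<in> alternating_GL n. det A = d \<and> mat_trace (A * T) = t}"

lemma finite_alternating_GL: "finite (alternating_GL n :: 'a::{field,finite} mat set)"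
proof (rule finite_subset)
  show "alternating_GL n \<subseteq>
    (\<lambda>f. mat n n f) ` (({..<n} \<times> {..<n}) \<rightarrow>\<^sub>E (UNIV :: 'a set))"
  proof
    fix A :: "'a mat"
    assume "A \<in> alternating_GL n"
    then have "A = mat n n (restrict (\<lambda>ij. A $$ ij) ({..<n} \<times> {..<n}))"
      unfolding alternating_GL_iff by (intro eq_matI) auto
    moreover have "restrict (\<lambda>ij. A $$ ij) ({..<n} \<times> {..<n}) \<in> ({..<n} \<times> {..<n}) \<rightarrow>\<^sub>E UNIV"
      by auto
    ultimately show "A \<in> (\<lambda>f. mat n n f) ` (({..<n} \<times> {..<n}) \<rightarrow>\<^sub>E UNIV)"
      by (rule image_eqI)
  qed
qed (intro finite_imageI finite_PiE; simp)

lemma finite_trace_fibre: "finite (trace_fibre n (T :: 'a::{field,finite} mat) d t)"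
  unfolding trace_fibre_def by (rule finite_subset[OF _ finite_alternating_GL]) auto

lemma obtain_inverse_mat:
  fixes P :: "'a::field mat"
  assumes "P \<in> carrier_mat n n" "det P \<noteq> 0"
  obtains Q where "Q \<in> carrier_mat n n" "P * Q = 1\<^sub>m n" "Q * P = 1\<^sub>m n" "det Q \<noteq> 0"
proof -
  from det_non_zero_imp_unit[OF assms, of undefined] obtain Q where
    Q: "Q \<in> carrier_mat n n" "Q * P = 1\<^sub>m n" "P * Q = 1\<^sub>m n"
    unfolding Units_def ring_mat_def by auto
  then have "det Q \<noteq> 0"
    using det_mult[OF Q(1) assms(1)] by auto
  with Q that show ?thesis by blast
qed

lemma inj_on_congr_mat:
  fixes P :: "'a::field mat"
  assumes P: "P \<in> carrier_mat n n" "det P \<noteq> 0" and X: "X \<subseteq> carrier_mat n n"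
  shows "inj_on (congr_mat P) X"
proof -
  obtain Q where "Q \<in> carrier_mat n n" "Q * P = 1\<^sub>m n"
    using obtain_inverse_mat[OF P] by blast
  then show ?thesis
    using congr_mat_cancel[OF P(1)] X by (intro inj_on_inverseI[of _ "congr_mat Q"]) auto
qed

lemma mat_trace_congr_mat:
  assumes P: "P \<in> carrier_mat n n" and A: "A \<in> carrier_mat n n" and T: "T \<in> carrier_mat n n"
  shows "mat_trace (A * congr_mat P T) = mat_trace (congr_mat (transpose_mat P) A * T)"
proof -
  note [simp] = assoc_mult_mat[of _ n n _ n _ n]
  have "mat_trace (A * congr_mat P T) = mat_trace ((A * P * T) * transpose_mat P)"
    unfolding congr_mat_def using assms by simp
  also have "\<dots> = mat_trace (transpose_mat P * (A * P * T))"
    using assms by (intro mat_trace_comm[of _ n]) auto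
  also have "\<dots> = mat_trace (congr_mat (transpose_mat P) A * T)"
    unfolding congr_mat_def using assms by simp
  finally show ?thesis .
qed

lemma card_trace_fibre_congr:
  fixes P T :: "'a::{field,finite} mat"
  assumes P: "P \<in> carrier_mat n n" "det P \<noteq> 0" and T: "T \<in> carrier_mat n n"
  shows "card (trace_fibre n (congr_mat P T) d t) = card (trace_fibre n T ((det P)\<^sup>2 * d) t)"
proof (rule bij_betw_same_card)
  let ?P = "transpose_mat P"
  have PT: "?P \<in> carrier_mat n n" "det ?P = det P"
    using P det_transpose[OF P(1)] by auto
  obtain Q where Q: "Q \<in> carrier_mat n n" "?P * Q = 1\<^sub>m n" "Q * ?P = 1\<^sub>m n" "det Q \<noteq> 0"
    using obtain_inverse_mat[of ?P n] PT P by metis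
  have dPQ: "det P * det Q = 1"
    using det_mult[OF PT(1) Q(1)] Q(2) PT(2) by simp
  show "bij_betw (congr_mat ?P) (trace_fibre n (congr_mat P T) d t)
    (trace_fibre n T ((det P)\<^sup>2 * d) t)"
  proof (rule bij_betw_byWitness[where f' = "congr_mat Q"])
    show "\<forall>A\<in>trace_fibre n (congr_mat P T) d t. congr_mat Q (congr_mat ?P A) = A"
      using congr_mat_cancel[OF PT(1) Q(1) _ Q(3)]
      by (auto simp: trace_fibre_def alternating_GL_iff)
    show Q_inv: "\<forall>A\<in>trace_fibre n T ((det P)\<^sup>2 * d) t. congr_mat ?P (congr_mat Q A) = A"
      using congr_mat_cancel[OF Q(1) PT(1) _ Q(2)]
      by (auto simp: trace_fibre_def alternating_GL_iff)
    show "congr_mat ?P ` trace_fibre n (congr_mat P T) d t \<subseteq> trace_fibre n T ((det P)\<^sup>2 * d) t"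
    proof (clarify)
      fix A assume "A \<in> trace_fibre n (congr_mat P T) d t"
      then have A: "A \<in> alternating_GL n" "A \<in> carrier_mat n n" "det A = d"
        "mat_trace (A * congr_mat P T) = t"
        by (auto simp: trace_fibre_def alternating_GL_iff)
      show "congr_mat ?P A \<in> trace_fibre n T ((det P)\<^sup>2 * d) t"
        using congr_mat_alternating_GL[OF PT(1) _ A(1)] det_congr_mat[OF PT(1) A(2)]
          mat_trace_congr_mat[OF P(1) A(2) T] A(3,4) PT(2) P(2)
        unfolding trace_fibre_def by simp
    qed
    show "congr_mat Q ` trace_fibre n T ((det P)\<^sup>2 * d) t \<subseteq> trace_fibre n (congr_mat P T) d t"
    proof (clarify)
      fix A assume A0: "A \<in> trace_fibre n T ((det P)\<^sup>2 * d) t"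
      then have A: "A \<in> alternating_GL n" "A \<in> carrier_mat n n" "det A = (det P)\<^sup>2 * d"
        "mat_trace (A * T) = t"
        by (auto simp: trace_fibre_def alternating_GL_iff)
      have "det (congr_mat Q A) = (det P * det Q)\<^sup>2 * d"
        using det_congr_mat[OF Q(1) A(2)] A(3) by (simp add: power_mult_distrib)
      moreover have "mat_trace (congr_mat Q A * congr_mat P T) = t"
        using mat_trace_congr_mat[OF P(1) congr_mat_carrier[OF Q(1) A(2)] T] Q_inv A0 A(4) by simp
      ultimately show "congr_mat Q A \<in> trace_fibre n (congr_mat P T) d t"
        using congr_mat_alternating_GL[OF Q(1,4) A(1)] dPQ unfolding trace_fibre_def by simp
    qed
  qed
qed

section \<open>Recursion for the fibres\<close>

lemma bordered_index:
  assumes "C \<in> carrier_mat 2 n" "D \<in> carrier_mat n n"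
  shows "bordered x C D $$ (0, Suc 0) = x"
    and "i < 2 \<Longrightarrow> j < n \<Longrightarrow> bordered x C D $$ (i, Suc (Suc j)) = C $$ (i, j)"
    and "i < n \<Longrightarrow> j < n \<Longrightarrow> bordered x C D $$ (Suc (Suc i), Suc (Suc j)) = D $$ (i, j)"
  using assms unfolding bordered_def by auto

lemma mat_trace_four_block:
  assumes A: "A \<in> carrier_mat k k" and D: "D \<in> carrier_mat n n"
  shows "mat_trace (four_block_mat A B C D) = mat_trace A + mat_trace D"
proof -
  let ?M = "four_block_mat A B C D"
  have split: "{..<k + n} = {..<k} \<union> (+) k ` {..<n}"
    by (subst lessThan_atLeast0[of n]) (auto simp: image_add_atLeastLessThan simp del: image_add_0)
  have "mat_trace ?M = (\<Sum>i\<in>{..<k}. ?M $$ (i, i)) + (\<Sum>i\<in>(+) k ` {..<n}. ?M $$ (i, i))"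
    unfolding mat_trace_def using A D
    by (simp only: index_mat_four_block carrier_matD split) (rule sum.union_disjoint; auto)
  also have "(\<Sum>i\<in>(+) k ` {..<n}. ?M $$ (i, i)) = (\<Sum>i<n. ?M $$ (k + i, k + i))"
    by (subst sum.reindex) auto
  finally show ?thesis
    unfolding mat_trace_def using A D by simp
qed

lemma mat_trace_bordered:
  fixes x b :: "'a::comm_ring_1"
  assumes C: "C \<in> carrier_mat 2 n" and D: "D \<in> carrier_mat n n" and S: "S \<in> carrier_mat n n"
  shows "mat_trace (bordered x C D * bordered b (0\<^sub>m 2 n) S) = mat_trace (D * S) - 2 * x * b"
proof -
  let ?U = "alt2 x * alt2 b + C * 0\<^sub>m n 2"
  let ?V = "- transpose_mat C * 0\<^sub>m 2 n + D * S"
  have "bordered x C D * bordered b (0\<^sub>m 2 n) S =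
    four_block_mat ?U (alt2 x * 0\<^sub>m 2 n + C * S) (- transpose_mat C * alt2 b + D * 0\<^sub>m n 2) ?V"
    unfolding bordered_zero unfolding bordered_def
    using C D S by (intro mult_four_block_mat) auto
  moreover have "?U = - (x * b) \<cdot>\<^sub>m 1\<^sub>m 2" "?V = D * S"
    using C D S by (auto simp: alt2_mult)
  ultimately show ?thesis
    using D S by (simp add: mat_trace_four_block[of _ 2 _ n]) (simp add: mat_trace_def)
qed

lemma mat_trace_alternating:
  fixes A :: "'a::field mat"
  assumes A: "A \<in> carrier_mat (2 + n) (2 + n)" "transpose_mat A = - A" and c: "(2::'a) \<noteq> 0"
    and S: "S \<in> carrier_mat n n"
  shows "mat_trace (A * bordered b (0\<^sub>m 2 n) S) =
    mat_trace (mat n n (\<lambda>(i, j). A $$ (i + 2, j + 2)) * S) - 2 * A $$ (0, 1) * b"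
  by (subst alternating_eq_bordered[OF A c]) (rule mat_trace_bordered; use S in simp)

definition border_row :: "nat \<Rightarrow> (nat \<Rightarrow> 'a) \<Rightarrow> 'a::zero mat"
  where "border_row n w = mat 2 n (\<lambda>(i, j). if i = 1 then w j else 0)"

lemma border_row_carrier [simp]: "border_row n w \<in> carrier_mat 2 n"
  unfolding border_row_def by simp

text \<open>
  The correction term in the Schur complement consists of multiples of the two-rowed minors of the
  border. The first row of the border is zero, so they vanish and the determinant ignores the border.
\<close>
lemma det_bordered_border_row:
  fixes D :: "'a::field mat"
  assumes x: "x \<noteq> 0" and D: "D \<in> carrier_mat n n"
  shows "det (bordered x (border_row n w) D) = x\<^sup>2 * det D"
proof -
  let ?C = "border_row n w"
  have "transpose_mat ?C * alt2 (1 / x) * ?C = 0\<^sub>m n n"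
    by (rule eq_matI) (auto simp: border_row_def scalar_prod_def sum_below_2)
  then have S: "D - transpose_mat ?C * alt2 (1 / x) * ?C = D"
    using D by auto
  obtain L where "L \<in> carrier_mat (2 + n) (2 + n)" "det L = 1"
    "bordered x ?C D = congr_mat L (bordered x (0\<^sub>m 2 n) D)"
    using bordered_congruent_diagonal[OF x border_row_carrier[of n w] D] unfolding S by metis
  then show ?thesis
    using det_congr_mat[of L "2 + n" "bordered x (0\<^sub>m 2 n) D"] bordered_carrier[OF D]
      det_bordered_zero[OF D] by simp
qed

text \<open>
  The matrices in which index \<open>0\<close> is linked to index \<open>1\<close> only, when an alternating matrix is viewed as
  a weighted graph on its indices; \<open>linked_fibre\<close> below is the complementary part of the fibre.
\<close>
definition isolated_fibre :: "nat \<Rightarrow> 'a::field \<Rightarrow> 'a mat \<Rightarrow> 'a \<Rightarrow> 'a \<Rightarrow> 'a mat set"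
  where "isolated_fibre n b S d t =
    {A \<in> trace_fibre (2 + n) (bordered b (0\<^sub>m 2 n) S) d t. \<forall>j<n. A $$ (0, j + 2) = 0}"

text \<open>
  The parametrisation behind the recursion: \<open>x\<close> is the entry at \<open>(0, 1)\<close>, \<open>w\<close> the rest of row \<open>1\<close>, and
  \<open>D\<close> the lower right block. The determinant is multiplied by \<open>x^2\<close> and the trace shifted by
  \<open>- 2 x b\<close>, whatever \<open>w\<close> is.
\<close>
lemma isolated_fibre_eq_image:
  fixes S :: "'a::field mat"
  assumes c: "(2::'a) \<noteq> 0" and S: "S \<in> carrier_mat n n"
  shows "isolated_fibre n b S d t =
    (\<lambda>(x, w, D). bordered x (border_row n w) D) `
      (SIGMA x:UNIV - {0}. ({..<n} \<rightarrow>\<^sub>E UNIV) \<times> trace_fibre n S (d / x\<^sup>2) (t + 2 * x * b))"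
    (is "_ = ?f ` ?X")
proof
  show "isolated_fibre n b S d t \<subseteq> ?f ` ?X"
  proof
    fix A assume "A \<in> isolated_fibre n b S d t"
    then have A: "A \<in> alternating_GL (2 + n)" "A \<in> carrier_mat (2 + n) (2 + n)"
        "transpose_mat A = - A" "det A \<noteq> 0" "det A = d"
      and tr: "mat_trace (A * bordered b (0\<^sub>m 2 n) S) = t"
      and zero: "\<And>j. j < n \<Longrightarrow> A $$ (0, j + 2) = 0"
      unfolding isolated_fibre_def trace_fibre_def by (auto simp: alternating_GL_iff)
    define x where "x = A $$ (0, 1)"
    define w where "w = restrict (\<lambda>j. A $$ (1, j + 2)) {..<n}"
    define D where "D = mat n n (\<lambda>(i, j). A $$ (i + 2, j + 2))"
    have D: "D \<in> carrier_mat n n" unfolding D_def by simp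
    have row: "border_row n w = mat 2 n (\<lambda>(i, j). A $$ (i, j + 2))"
      unfolding border_row_def w_def using zero by (intro eq_matI) (auto simp: less_2_cases_iff)
    have A_eq: "A = bordered x (border_row n w) D"
      using alternating_eq_bordered[OF A(2,3) c] unfolding row x_def D_def .
    have x: "x \<noteq> 0"
    proof
      assume x0: "x = 0"
      have "A $$ (0, j) = 0" if "j < 2 + n" for j
      proof -
        consider "j = 0" | "j = 1" | "2 \<le> j" by linarith
        then show ?thesis
        proof cases
          case 1
          then show ?thesis using alternating_diag[OF c A(2,3), of 0] by simp
        next
          case 2
          then show ?thesis using x0 unfolding x_def by simp
        next
          case 3
          then obtain k where "j = k + 2" by (metis le_Suc_ex add.commute)
          then show ?thesis using zero[of k] that by simp
        qed
      qed
      then show False using alternating_GL_row_nonzero[OF A(1), of 0] by auto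
    qed
    have dA: "det A = x\<^sup>2 * det D"
      using det_bordered_border_row[OF x D] A_eq by simp
    have "transpose_mat D = - D"
      unfolding D_def by (rule lower_right_alternating[OF A(2,3)])
    moreover have "det D \<noteq> 0" "det D = d / x\<^sup>2"
      using dA A(4,5) x by auto
    moreover have "mat_trace (D * S) = t + 2 * x * b"
      using mat_trace_bordered[OF border_row_carrier[of n w] D S, of x b] tr
      unfolding A_eq[symmetric] by (simp add: algebra_simps)
    ultimately have "D \<in> trace_fibre n S (d / x\<^sup>2) (t + 2 * x * b)"
      using D unfolding trace_fibre_def alternating_GL_iff by simp
    then show "A \<in> ?f ` ?X"
      using x A_eq by (intro image_eqI[of _ _ "(x, w, D)"]) (auto simp: w_def)
  qed
  show "?f ` ?X \<subseteq> isolated_fibre n b S d t"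
  proof (rule image_subsetI)
    fix p assume "p \<in> ?X"
    then obtain x w D where p: "p = (x, w, D)" and x: "x \<noteq> 0"
      and "D \<in> trace_fibre n S (d / x\<^sup>2) (t + 2 * x * b)"
      by auto
    then have D: "D \<in> carrier_mat n n" "transpose_mat D = - D" "det D \<noteq> 0" "det D = d / x\<^sup>2"
      "mat_trace (D * S) = t + 2 * x * b"
      unfolding trace_fibre_def by (auto simp: alternating_GL_iff)
    let ?A = "bordered x (border_row n w) D"
    have dA: "det ?A = x\<^sup>2 * det D" by (rule det_bordered_border_row[OF x D(1)])
    have "?A \<in> alternating_GL (2 + n)"
      unfolding alternating_GL_iff
      using bordered_carrier[OF D(1)] transpose_bordered[OF border_row_carrier D(1,2)] dA D(3) x
      by simp
    moreover have "det ?A = d" using dA D(4) x by simp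
    moreover have "mat_trace (?A * bordered b (0\<^sub>m 2 n) S) = t"
      using mat_trace_bordered[OF border_row_carrier D(1) S, of x w b] D(5) by simp
    moreover have "\<forall>j<n. ?A $$ (0, j + 2) = 0"
      using bordered_index(2)[OF border_row_carrier D(1), of 0] by (simp add: border_row_def)
    ultimately show "?f p \<in> isolated_fibre n b S d t"
      unfolding p isolated_fibre_def trace_fibre_def by simp
  qed
qed

lemma inj_on_bordered_border_row:
  "inj_on (\<lambda>(x, w, D). bordered x (border_row n w) D)
    (UNIV \<times> ({..<n} \<rightarrow>\<^sub>E UNIV) \<times> carrier_mat n n)"
    (is "inj_on ?f ?X")
proof (rule inj_onI)
  fix p p'
  assume "p \<in> ?X" "p' \<in> ?X" "?f p = ?f p'"
  then obtain x v D y w E where p: "p = (x, v, D)" "p' = (y, w, E)"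
    and v: "v \<in> {..<n} \<rightarrow>\<^sub>E UNIV" and w: "w \<in> {..<n} \<rightarrow>\<^sub>E UNIV"
    and D: "D \<in> carrier_mat n n" and E: "E \<in> carrier_mat n n"
    and eq: "bordered x (border_row n v) D = bordered y (border_row n w) E"
    by auto
  note D' = bordered_index[OF border_row_carrier[of n v] D, where x = x]
  note E' = bordered_index[OF border_row_carrier[of n w] E, where x = y]
  have "x = y" using D'(1) E'(1) eq by simp
  moreover have "v = w"
  proof (rule PiE_ext[OF v w])
    fix j assume "j \<in> {..<n}"
    then show "v j = w j"
      using D'(2)[of 1 j] E'(2)[of 1 j] eq by (simp add: border_row_def)
  qed
  moreover have "D = E"
  proof (rule eq_matI)
    fix i j assume "i < dim_row E" "j < dim_col E"
    then show "D $$ (i, j) = E $$ (i, j)"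
      using D'(3)[of i j] E'(3)[of i j] eq E by simp
  qed (use D E in auto)
  ultimately show "p = p'" unfolding p by simp
qed

lemma card_isolated_fibre:
  fixes S :: "'a::{field,finite} mat"
  assumes c: "(2::'a) \<noteq> 0" and S: "S \<in> carrier_mat n n"
  shows "card (isolated_fibre n b S d t) =
    (\<Sum>x\<in>UNIV - {0}. CARD('a) ^ n * card (trace_fibre n S (d / x\<^sup>2) (t + 2 * x * b)))"
proof -
  let ?X = "SIGMA x:UNIV - {0}. ({..<n} \<rightarrow>\<^sub>E (UNIV :: 'a set)) \<times>
    trace_fibre n S (d / x\<^sup>2) (t + 2 * x * b)"
  have "card (isolated_fibre n b S d t) = card ?X"
    unfolding isolated_fibre_eq_image[OF c S]
    by (rule card_image, rule inj_on_subset[OF inj_on_bordered_border_row])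
      (auto simp: trace_fibre_def alternating_GL_iff)
  also have "\<dots> = (\<Sum>x\<in>UNIV - {0}. card (({..<n} \<rightarrow>\<^sub>E (UNIV :: 'a set)) \<times>
    trace_fibre n S (d / x\<^sup>2) (t + 2 * x * b)))"
    by (rule card_SigmaI) (auto intro!: finite_cartesian_product finite_PiE finite_trace_fibre)
  finally show ?thesis
    by (simp add: card_cartesian_product card_funcsetE)
qed

definition linked_fibre :: "nat \<Rightarrow> 'a::field \<Rightarrow> 'a mat \<Rightarrow> 'a \<Rightarrow> 'a \<Rightarrow> 'a mat set"
  where "linked_fibre n b S d t =
    {A \<in> trace_fibre (2 + n) (bordered b (0\<^sub>m 2 n) S) d t. \<exists>j<n. A $$ (0, j + 2) \<noteq> 0}"

text \<open>
  The injection is a transvection that depends on the matrix: pick the first \<open>j\<close> with a nonzero entry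
  at \<open>(0, j + 2)\<close>, and choose the coefficient so that the trace becomes \<open>t'\<close>. Neither the choice of
  \<open>j\<close> nor the coefficient is affected by the transvection itself, because row \<open>0\<close> changes only at
  position \<open>1\<close>; so the transvection can be read off from its result and undone.
\<close>
lemma card_linked_fibre_le:
  fixes S :: "'a::{field,finite} mat"
  assumes c: "(2::'a) \<noteq> 0" and b: "b \<noteq> 0" and S: "S \<in> carrier_mat n n"
  shows "card (linked_fibre n b S d t) \<le> card (linked_fibre n b S d t')"
proof -
  define piv where "piv A = (LEAST j. j < n \<and> A $$ (0, j + 2) \<noteq> 0)" for A :: "'a mat"
  \<comment> \<open>The trace changes by \<open>- 2 b s A\<^sub>0\<^sub>j\<close>, which has to equal \<open>t' - t\<close>.\<close>
  define s where "s A = (t - t') / (2 * b * A $$ (0, piv A + 2))" for A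
  define E where "E a j = addrow_mat (2 + n) (a::'a) 1 (j + 2)" for a j
  define f where "f A = congr_mat (E (s A) (piv A)) A" for A
  have E: "E a j \<in> carrier_mat (2 + n) (2 + n)" "det (E a j) = 1" for a j
    unfolding E_def by (auto simp: det_addrow_mat)
  have inv: "E (- a) j * E a j = 1\<^sub>m (2 + n)" if "j < n" for a j
    using addrow_mat_inv[of 1 "2 + n" "j + 2" "- a"] that unfolding E_def by simp
  have props: "A \<in> alternating_GL (2 + n) \<and> A \<in> carrier_mat (2 + n) (2 + n) \<and>
      transpose_mat A = - A \<and> det A = d \<and>
      mat_trace (A * bordered b (0\<^sub>m 2 n) S) = t \<and> piv A < n \<and> A $$ (0, piv A + 2) \<noteq> 0"
    if "A \<in> linked_fibre n b S d t" for A
  proof -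
    have "\<exists>j. j < n \<and> A $$ (0, j + 2) \<noteq> 0"
      using that unfolding linked_fibre_def by auto
    from LeastI_ex[OF this] show ?thesis
      using that unfolding linked_fibre_def trace_fibre_def piv_def
      by (auto simp: alternating_GL_iff)
  qed
  have top: "f A $$ (0, 1) = A $$ (0, 1) + s A * A $$ (0, piv A + 2)"
    and row: "\<And>j. j < n \<Longrightarrow> f A $$ (0, j + 2) = A $$ (0, j + 2)"
    and low: "\<And>i j. i < n \<Longrightarrow> j < n \<Longrightarrow> f A $$ (i + 2, j + 2) = A $$ (i + 2, j + 2)"
    if A: "A \<in> linked_fibre n b S d t" for A
  proof -
    note p = props[OF A]
    have idx: "f A $$ (i, j) = A $$ (i, j) + (if i = 1 then s A * A $$ (piv A + 2, j) else 0)
        + (if j = 1 then s A * A $$ (i, piv A + 2) else 0)" if "i < 2 + n" "j < 2 + n" for i j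
      unfolding f_def E_def using p that c by (intro congr_mat_addrow_index) auto
    show "f A $$ (0, 1) = A $$ (0, 1) + s A * A $$ (0, piv A + 2)"
      using idx[of 0 1] by simp
    show "\<And>j. j < n \<Longrightarrow> f A $$ (0, j + 2) = A $$ (0, j + 2)"
      using idx[of 0] by simp
    show "\<And>i j. i < n \<Longrightarrow> j < n \<Longrightarrow> f A $$ (i + 2, j + 2) = A $$ (i + 2, j + 2)"
      using idx by simp
  qed
  have maps: "f A \<in> linked_fibre n b S d t'" if A: "A \<in> linked_fibre n b S d t" for A
  proof -
    note p = props[OF A]
    have G: "f A \<in> alternating_GL (2 + n)"
      unfolding f_def using p E by (intro congr_mat_alternating_GL) auto
    then have G': "f A \<in> carrier_mat (2 + n) (2 + n)" "transpose_mat (f A) = - f A"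
      unfolding alternating_GL_iff by auto
    have det: "det (f A) = d"
      unfolding f_def using det_congr_mat[OF E(1), of A] p E(2) by simp
    have low_eq: "mat n n (\<lambda>(i, j). f A $$ (i + 2, j + 2)) = mat n n (\<lambda>(i, j). A $$ (i + 2, j + 2))"
      using low[OF A] by (intro eq_matI) auto
    have "mat_trace (f A * bordered b (0\<^sub>m 2 n) S) =
      mat_trace (A * bordered b (0\<^sub>m 2 n) S) - 2 * b * (s A * A $$ (0, piv A + 2))"
    proof -
      have e: "mat_trace (A * bordered b (0\<^sub>m 2 n) S) =
        mat_trace (mat n n (\<lambda>(i, j). A $$ (i + 2, j + 2)) * S) - 2 * A $$ (0, 1) * b"
        using p by (intro mat_trace_alternating c S) auto
      show ?thesis
        unfolding mat_trace_alternating[OF G' c S, of b] e low_eq top[OF A]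
        by (simp add: algebra_simps)
    qed
    also have "\<dots> = t'"
      using p b c unfolding s_def by simp
    finally show ?thesis
      using G det row[OF A] p unfolding linked_fibre_def trace_fibre_def by auto
  qed
  have inj: "inj_on f (linked_fibre n b S d t)"
  proof (rule inj_onI)
    fix A B assume A: "A \<in> linked_fibre n b S d t" and B: "B \<in> linked_fibre n b S d t"
      and eq: "f A = f B"
    have rows: "A $$ (0, j + 2) = B $$ (0, j + 2)" if "j < n" for j
      using row[OF A that] row[OF B that] eq by simp
    then have piv: "piv A = piv B"
      unfolding piv_def by (metis (no_types, lifting))
    then have s: "s A = s B"
      unfolding s_def using rows[of "piv B"] props[OF B] by simp
    have "A = congr_mat (E (- s A) (piv A)) (f A)"
      unfolding f_def using props[OF A] by (intro congr_mat_cancel[OF E(1) E(1) _ inv, symmetric]) auto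
    also have "\<dots> = congr_mat (E (- s B) (piv B)) (f B)"
      using eq piv s by simp
    also have "\<dots> = B"
      unfolding f_def using props[OF B] by (intro congr_mat_cancel[OF E(1) E(1) _ inv]) auto
    finally show "A = B" .
  qed
  show ?thesis
    using maps by (intro card_inj_on_le[OF inj])
      (auto simp: linked_fibre_def intro: finite_subset[OF _ finite_trace_fibre])
qed

text \<open>
  Since \<open>t\<close> and \<open>t'\<close> may be exchanged, this bounds \<open>\<bar>F(d, t) - F(d, t')\<bar>\<close> by \<open>K\<close>. The bound has to be
  uniform in \<open>d\<close>, because the recursion and congruences of \<open>T\<close> change the determinant.
\<close>
definition near_uniform :: "nat \<Rightarrow> nat \<Rightarrow> 'a::field mat \<Rightarrow> bool"
  where "near_uniform K n T \<longleftrightarrow>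
    (\<forall>d t t'. card (trace_fibre n T d t) \<le> card (trace_fibre n T d t') + K)"

lemma near_uniform_bordered:
  fixes S :: "'a::{field,finite} mat"
  assumes c: "(2::'a) \<noteq> 0" and b: "b \<noteq> 0" and S: "S \<in> carrier_mat n n"
    and K: "near_uniform K n S"
  shows "near_uniform (CARD('a) ^ n * (CARD('a) - 1) * K) (2 + n) (bordered b (0\<^sub>m 2 n) S)"
  unfolding near_uniform_def
proof (intro allI)
  fix d t t' :: 'a
  let ?F = "trace_fibre (2 + n) (bordered b (0\<^sub>m 2 n) S) d"
  let ?c = "\<lambda>x t. card (trace_fibre n S (d / x\<^sup>2) (t + 2 * x * b))"
  have split: "card (?F t) = card (isolated_fibre n b S d t) + card (linked_fibre n b S d t)" for t
  proof -
    have "?F t = isolated_fibre n b S d t \<union> linked_fibre n b S d t"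
      unfolding isolated_fibre_def linked_fibre_def by auto
    moreover have "finite (isolated_fibre n b S d t)" "finite (linked_fibre n b S d t)"
      unfolding isolated_fibre_def linked_fibre_def
      by (auto intro: finite_subset[OF _ finite_trace_fibre])
    moreover have "isolated_fibre n b S d t \<inter> linked_fibre n b S d t = {}"
      unfolding isolated_fibre_def linked_fibre_def by auto
    ultimately show ?thesis by (simp add: card_Un_disjoint)
  qed
  have "card (isolated_fibre n b S d t) \<le> (\<Sum>x\<in>UNIV - {0}. CARD('a) ^ n * (?c x t' + K))"
    unfolding card_isolated_fibre[OF c S]
    using K unfolding near_uniform_def by (intro sum_mono mult_le_mono2) auto
  also have "\<dots> = card (isolated_fibre n b S d t') + CARD('a) ^ n * (CARD('a) - 1) * K"
    unfolding card_isolated_fibre[OF c S]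
    by (simp add: algebra_simps sum.distrib card_Diff_singleton)
  finally show "card (?F t) \<le> card (?F t') + CARD('a) ^ n * (CARD('a) - 1) * K"
    unfolding split using card_linked_fibre_le[OF c b S, of d t t'] by linarith
qed

text \<open>
  For \<open>m = 0\<close> the only matrix is the empty one, so a fibre has at most one element and the bound \<open>1\<close>
  is right; each further block contributes the factor \<open>q^(2m) (q-1)\<close>.
\<close>
lemma near_uniform_alternating_GL:
  fixes T :: "'a::{field,finite} mat"
  assumes c: "(2::'a) \<noteq> 0" and T: "T \<in> alternating_GL (2 * m)"
  shows "near_uniform (CARD('a) ^ (m * (m - 1)) * (CARD('a) - 1) ^ m) (2 * m) T"
  using c T
proof (induction rule: alternating_GL_induct)
  case (empty T)
  have *: "card (trace_fibre 0 T d t) \<le> 1" for d t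
    unfolding card_le_Suc0_iff_eq[OF finite_trace_fibre] One_nat_def
    by (auto simp: trace_fibre_def alternating_GL_iff)
  show ?case
    unfolding near_uniform_def
  proof (intro allI)
    fix d t t'
    show "card (trace_fibre (2 * 0) T d t) \<le> card (trace_fibre (2 * 0) T d t') +
      CARD('a) ^ (0 * (0 - 1)) * (CARD('a) - 1) ^ 0"
      using *[of d t] by simp
  qed
next
  case (block m b S)
  have "CARD('a) ^ (2 * m) * (CARD('a) - 1) * (CARD('a) ^ (m * (m - 1)) * (CARD('a) - 1) ^ m) =
    CARD('a) ^ (2 * m + m * (m - 1)) * (CARD('a) - 1) ^ Suc m"
    by (simp add: power_add mult_ac)
  also have "2 * m + m * (m - 1) = Suc m * (Suc m - 1)"
    by (cases m) (simp_all add: algebra_simps)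
  finally have K: "CARD('a) ^ (2 * m) * (CARD('a) - 1) *
      (CARD('a) ^ (m * (m - 1)) * (CARD('a) - 1) ^ m) =
    CARD('a) ^ (Suc m * (Suc m - 1)) * (CARD('a) - 1) ^ Suc m" .
  have "S \<in> carrier_mat (2 * m) (2 * m)" "2 * Suc m = 2 + 2 * m"
    using block(2) by (simp_all add: alternating_GL_iff)
  then show ?case
    using near_uniform_bordered[OF c block(1) _ block(3)] unfolding K by metis
next
  case (congr m P S)
  then show ?case
    unfolding near_uniform_def by (simp add: card_trace_fibre_congr alternating_GL_iff)
qed

section \<open>The mean over all traces\<close>

lemma card_square_roots:
  fixes s :: "'a::field"
  assumes "(2::'a) \<noteq> 0" "s \<noteq> 0"
  shows "card {x. x \<noteq> 0 \<and> s\<^sup>2 = x\<^sup>2} = 2"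
proof -
  have "{x. x \<noteq> 0 \<and> s\<^sup>2 = x\<^sup>2} = {s, - s}"
    using assms(2) by (auto simp: power2_eq_iff)
  moreover have "s \<noteq> - s"
    using assms by (metis add.right_inverse mult_2 mult_eq_0_iff)
  ultimately show ?thesis by simp
qed

text \<open>
  Congruence by \<open>diag(x / s, 1, ..., 1)\<close> is injective and multiplies determinants by \<open>(x / s)^2\<close>.
\<close>
lemma card_det_fibre_le:
  fixes s x :: "'a::{field,finite}"
  assumes s: "s \<noteq> 0" and x: "x \<noteq> 0" and n: "n > 0"
  shows "card {A \<in> alternating_GL n. det A = s\<^sup>2} \<le> card {A \<in> alternating_GL n. det A = x\<^sup>2}"
proof (rule card_inj_on_le)
  let ?P = "multrow_mat n 0 (x / s)"
  have P: "?P \<in> carrier_mat n n" "det ?P = x / s"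
    using det_multrow_mat[OF n] by auto
  show "inj_on (congr_mat ?P) {A \<in> alternating_GL n. det A = s\<^sup>2}"
    using P s x by (intro inj_on_congr_mat) (auto simp: alternating_GL_iff)
  show "congr_mat ?P ` {A \<in> alternating_GL n. det A = s\<^sup>2} \<subseteq> {A \<in> alternating_GL n. det A = x\<^sup>2}"
  proof clarify
    fix A assume A: "A \<in> alternating_GL n" "det A = s\<^sup>2"
    then have "det (congr_mat ?P A) = x\<^sup>2"
      using det_congr_mat[OF P(1), of A] s P(2) by (simp add: alternating_GL_iff power_divide)
    with A(1) P s x show "congr_mat ?P A \<in> alternating_GL n \<and> det (congr_mat ?P A) = x\<^sup>2"
      by (auto intro: congr_mat_alternating_GL)
  qed
qed (auto intro: finite_subset[OF _ finite_alternating_GL])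

text \<open>
  Double counting of the pairs \<open>(x, A)\<close> with \<open>det A = x^2\<close>: each of the \<open>q - 1\<close> nonzero \<open>x\<close> has equally
  many \<open>A\<close>, and each \<open>A\<close> has exactly two \<open>x\<close>, as its determinant is a nonzero square.
\<close>
lemma card_det_fibre:
  fixes s :: "'a::{field,finite}"
  assumes c: "(2::'a) \<noteq> 0" and s: "s \<noteq> 0" and m: "m > 0"
  shows "(CARD('a) - 1) * card {A \<in> alternating_GL (2 * m). det A = s\<^sup>2} =
    2 * card (alternating_GL (2 * m) :: 'a mat set)"
proof -
  let ?G = "alternating_GL (2 * m) :: 'a mat set"
  have "(CARD('a) - 1) * card {A \<in> ?G. det A = s\<^sup>2} =
    (\<Sum>x\<in>UNIV - {0::'a}. card {A \<in> ?G. det A = s\<^sup>2})"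
    by (simp add: card_Diff_singleton)
  also have "\<dots> = (\<Sum>x\<in>UNIV - {0::'a}. card {A \<in> ?G. det A = x\<^sup>2})"
    using s m by (intro sum.cong refl antisym card_det_fibre_le) auto
  also have "\<dots> = (\<Sum>A\<in>?G. card {x \<in> UNIV - {0}. det A = x\<^sup>2})"
    using finite_alternating_GL by (intro sum_multicount_gen) auto
  also have "\<dots> = (\<Sum>A\<in>?G. 2)"
  proof (rule sum.cong[OF refl])
    fix A assume "A \<in> ?G"
    then obtain r where r: "r \<noteq> 0" "det A = r\<^sup>2"
      using det_alternating_square[OF c] by blast
    then show "card {x \<in> UNIV - {0}. det A = x\<^sup>2} = 2"
      using card_square_roots[OF c r(1)] by simp
  qed
  finally show ?thesis by simp
qed

text \<open>
  Translation by \<open>1\<close> permutes the field, so the sum of all elements does not change when each one is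
  increased by \<open>1\<close>; thus \<open>q\<close> is zero in the field, and an odd number would be \<open>1\<close> if \<open>2\<close> were zero.
\<close>
lemma two_nonzero_if_odd_card:
  assumes "odd CARD('a::{field,finite})"
  shows "(2::'a) \<noteq> 0"
proof
  assume two: "(2::'a) = 0"
  have "(\<Sum>x\<in>UNIV. x) = (\<Sum>x\<in>UNIV. x + (1::'a))"
    by (rule sum.reindex_bij_betw[symmetric, of "\<lambda>x. x + 1"])
      (rule bij_betw_byWitness[where f' = "\<lambda>x. x - 1"]; auto)
  then have "of_nat CARD('a) = (0::'a)"
    by (simp add: sum.distrib)
  moreover obtain k where "CARD('a) = 2 * k + 1"
    using assms by (auto elim: oddE)
  ultimately show False using two by simp
qed

lemma deviation_from_mean:
  fixes f :: "'a::finite \<Rightarrow> nat"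
  assumes "\<And>t t'. f t \<le> f t' + K"
  shows "\<bar>real (f t) - real (\<Sum>t'\<in>UNIV. f t') / real CARD('a)\<bar> \<le> real K"
proof -
  have "\<bar>real (f t) - real (f t')\<bar> \<le> real K" for t'
    using assms[of t t'] assms[of t' t] by linarith
  then have "\<bar>\<Sum>t'\<in>UNIV. real (f t) - real (f t')\<bar> \<le> real CARD('a) * real K"
    by (intro order_trans[OF sum_abs] order_trans[OF sum_bounded_above]) auto
  moreover have "(\<Sum>t'\<in>UNIV. real (f t) - real (f t')) =
    real CARD('a) * (real (f t) - real (\<Sum>t'\<in>UNIV. f t') / real CARD('a))"
    by (simp add: sum_subtractf field_simps)
  ultimately show ?thesis
    by (simp add: abs_mult)
qed

section \<open>Deviation from the mean\<close>

theorem theorem1p0p6: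
  fixes d t :: "'a::{field,finite}" and T :: "'a mat" and m q :: nat
  assumes "q = CARD('a)" and "\<not> 2 dvd q" and "\<not> 3 dvd q"
    and "m > 0"
    and "d \<in> (\<lambda>x. x ^ 2) ` (UNIV - {0})"
    and "T \<in> alternating_GL (2 * m)"
  shows "\<bar>real (card {A \<in> alternating_GL (2 * m). det A = d \<and> mat_trace (A * T) = t})
            - real (card (alternating_GL (2 * m) :: 'a mat set)) / (real q * (real q - 1) / 2)\<bar>
         \<le> real q ^ (m * (m - 1)) * (real q - 1) ^ m"
proof -
  let ?G = "alternating_GL (2 * m) :: 'a mat set"
  let ?f = "\<lambda>t. card (trace_fibre (2 * m) T d t)"
  define M where "M = (\<Sum>t\<in>UNIV. ?f t)"
  have c: "(2::'a) \<noteq> 0"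
    using two_nonzero_if_odd_card assms(1,2) by simp
  obtain s where s: "s \<noteq> 0" "d = s\<^sup>2" using assms(5) by auto
  have q: "q > 1"
    using card_mono[of UNIV "{0, 1 :: 'a}"] assms(1) by simp
  have "{A \<in> ?G. det A = d} = (\<Union>t. trace_fibre (2 * m) T d t)"
    unfolding trace_fibre_def by auto
  moreover have "card (\<Union>t. trace_fibre (2 * m) T d t) = (\<Sum>t\<in>UNIV. ?f t)"
    by (rule card_UN_disjoint) (auto simp: finite_trace_fibre, auto simp: trace_fibre_def)
  ultimately have "(q - 1) * M = 2 * card ?G"
    using card_det_fibre[OF c s(1) assms(4)] s(2) assms(1) unfolding M_def by simp
  then have "real (q - 1) * real M = 2 * real (card ?G)"
    by (metis of_nat_mult of_nat_numeral)
  then have "real (card ?G) = (real q - 1) * real M / 2"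
    using q by (simp add: of_nat_diff)
  then have mean: "real M / real q = real (card ?G) / (real q * (real q - 1) / 2)"
    using q by simp
  have "\<bar>real (?f t) - real M / real q\<bar>
      \<le> real (q ^ (m * (m - 1)) * (q - 1) ^ m)"
    using near_uniform_alternating_GL[OF c assms(6)] unfolding near_uniform_def assms(1) M_def
    by (intro deviation_from_mean) simp
  then show ?thesis
    unfolding mean using q unfolding trace_fibre_def by (simp add: of_nat_diff)
qed

end
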